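(* Let $\sigma>0$, $\rho>0$ and let $N\ge1$ be an integer. For integers $j,m\ge0$ define $A_{j,m}=0$ if $j+m$ is odd, and $$A_{j,m}=(-1)^{\frac{m+j}{2}}\sqrt{\frac{2\rho\sigma}{2\rho+\sigma}}\left(\frac{2(\rho+\sigma)}{\sigma(2\rho+\sigma)}\right)^{\frac{m+j}{2}}\Gamma\!\left(\frac{m+j+1}{2}\right)\,{}_2F_1\!\left(-m,-j;\frac{1-m-j}{2};\frac{2\rho+\sigma}{2(\rho+\sigma)}\right)$$ if $j+m$ is even. Let $\mathbf A_N(0)=(A_{j,m})_{j,m=0}^{N-1}$ and $\mathbf A_N(1)=(A_{j,m+1})_{j,m=0}^{N-1}$. Then the eigenvalues of the matrix pencil $\lambda\,\mathbf A_N(0)-\mathbf A_N(1)$, i.e. the $\lambda\in\mathbb C$ with $\det(\lambda\mathbf A_N(0)-\mathbf A_N(1))=0$, are the zeros $\lambda$ of the scaled Hermite polynomial $$H_N\!\left(\mathrm i\sqrt{\frac{\sigma(2\rho+\sigma)}{2(\rho+\sigma)}}\;\lambda\right).$$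
   Context: The physicist's Hermite polynomials are $H_n(t)=(-1)^n\mathrm e^{t^2}\frac{\mathrm d^n}{\mathrm dt^n}\mathrm e^{-t^2}$. $\Gamma$ is the Gamma function, and ${}_2F_1(a,b;c;z)=\sum_{n=0}^\infty\frac{(a)_n(b)_n}{(c)_n}\frac{z^n}{n!}$ for $|z|<1$ is the hypergeometric function, with $(x)_n=x(x+1)\cdots(x+n-1)$ and $(x)_0=1$. *)

theory Defs
  imports
    "HOL-Analysis.Gamma_Function"
    "Jordan_Normal_Form.Determinant"
begin

(* The argument is complex, since the polynomial is evaluated on the imaginary axis;
   the derivative is accordingly the complex one. *)
definition hermite_H :: "nat \<Rightarrow> complex \<Rightarrow> complex" where
  "hermite_H n t = (-1) ^ n * exp (t\<^sup>2) * (deriv ^^ n) (\<lambda>s. exp (- (s\<^sup>2))) t"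

definition hyp2F1 :: "real \<Rightarrow> real \<Rightarrow> real \<Rightarrow> real \<Rightarrow> real" where
  "hyp2F1 a b c z =
     (\<Sum>n. pochhammer a n * pochhammer b n / pochhammer c n * (z ^ n / fact n))"

definition A_entry :: "real \<Rightarrow> real \<Rightarrow> nat \<Rightarrow> nat \<Rightarrow> real" where
  "A_entry \<sigma> \<rho> j m =
     (if odd (j + m) then 0
      else (-1) ^ ((m + j) div 2)
           * sqrt (2 * \<rho> * \<sigma> / (2 * \<rho> + \<sigma>))
           * (2 * (\<rho> + \<sigma>) / (\<sigma> * (2 * \<rho> + \<sigma>))) ^ ((m + j) div 2)
           * Gamma ((real m + real j + 1) / 2)
           * hyp2F1 (- real m) (- real j) ((1 - real m - real j) / 2)
               ((2 * \<rho> + \<sigma>) / (2 * (\<rho> + \<sigma>))))"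

(* Row index j, column index m; only the shifts k = 0 and k = 1 are used. *)
definition A_mat :: "real \<Rightarrow> real \<Rightarrow> nat \<Rightarrow> nat \<Rightarrow> complex mat" where
  "A_mat \<sigma> \<rho> N k = mat N N (\<lambda>(j, m). complex_of_real (A_entry \<sigma> \<rho> j (m + k)))"

end

theory Submission
  imports Defs
begin

text \<open>
  Put \<open>b = 2(\<rho> + \<sigma>) / (\<sigma>(2\<rho> + \<sigma>))\<close>, \<open>v = -b/2\<close> and \<open>u = v + 1/\<sigma> > 0\<close>. Expanding the terminating
  hypergeometric series shows that, up to a positive constant, the numbers \<open>A(j,m)\<close> have the
  exponential generating function \<open>exp (v (x + y)^2 / 2 + x y / \<sigma>)\<close>. Writing the exponent as
  \<open>v x^2 / 2 + v y^2 / 2 + u x y\<close> yields \<open>A = L D L^T\<close> with \<open>D\<close> diagonal and invertible and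
  \<open>L(j,k) = (j choose k) M(j-k)\<close> unitriangular, where \<open>M\<close> are the moments of a centred Gaussian of
  (negative) variance \<open>v\<close>. Shifting the column index multiplies \<open>L\<close> by the Jacobi matrix of the
  monic Hermite polynomials of variance \<open>v\<close>, so the pencil is singular exactly at the zeros of the
  \<open>N\<close>-th of these.
\<close>

section \<open>Gaussian moments and the unitriangular coefficients\<close>

text \<open>The recurrence serves as the definition because the variance needed later is negative,
  so the moments are not given by integrals against a real Gaussian density.\<close>

fun gauss_moment :: "real \<Rightarrow> nat \<Rightarrow> real" where
  "gauss_moment v 0 = 1"
| "gauss_moment v (Suc 0) = 0"
| "gauss_moment v (Suc (Suc n)) = v * (1 + real n) * gauss_moment v n"

text \<open>At \<open>n = 0\<close> the truncated \<open>n - 1\<close> is harmless since the factor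
  \<open>real n\<close> vanishes; later recurrences use the same convention.\<close>

lemma gauss_moment_Suc: "gauss_moment v (Suc n) = v * real n * gauss_moment v (n - 1)"
  by (cases n) auto

lemma gauss_moment_odd: "odd n \<Longrightarrow> gauss_moment v n = 0"
  by (induction v n rule: gauss_moment.induct) auto

text \<open>The recurrence factor \<open>v * (1 + 2 * p)\<close> is \<open>2 * v\<close> times
  \<open>p + 1 / 2\<close>, the factor in the functional equation of Gamma. This turns the Gamma
  values in \<open>A_entry\<close> into moments.\<close>

lemma gauss_moment_even:
  "sqrt pi * gauss_moment v (2 * p) = (2 * v) ^ p * Gamma (real p + 1 / 2)"
proof (induction p)
  case 0
  then show ?case by (simp add: Gamma_one_half_real)
next
  case (Suc p)
  have "Gamma (real (Suc p) + 1 / 2) = (real p + 1 / 2) * Gamma (real p + 1 / 2)"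
    using Gamma_plus1[of "real p + 1 / 2"] nonpos_Ints_nonpos[of "real p + 1 / 2"]
    by (force simp: add_ac)
  moreover have "sqrt pi * gauss_moment v (2 * Suc p)
      = v * (1 + 2 * real p) * (sqrt pi * gauss_moment v (2 * p))"
    by (simp add: algebra_simps)
  ultimately show ?case
    unfolding Suc.IH by (simp add: algebra_simps)
qed

text \<open>The coefficient of the \<open>k\<close>-th monic Hermite polynomial of variance
  \<open>v\<close> in the \<open>j\<close>-th power of the variable.\<close>

definition gauss_coeff :: "real \<Rightarrow> nat \<Rightarrow> nat \<Rightarrow> real" where
  "gauss_coeff v j k = real (j choose k) * gauss_moment v (j - k)"

lemma gauss_coeff_eq_0: "j < k \<Longrightarrow> gauss_coeff v j k = 0"
  by (simp add: gauss_coeff_def binomial_eq_0)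

lemma gauss_coeff_self: "gauss_coeff v j j = 1"
  by (simp add: gauss_coeff_def)

lemma real_Suc_times_binomial_pred:
  "real (Suc k) * real (j choose Suc k) = real j * real (j - 1 choose k)"
proof -
  have "Suc k * (j choose Suc k) = j * (j - 1 choose k)"
    using Suc_times_binomial[of k "j - 1"] by (cases j) auto
  then show ?thesis by (metis of_nat_mult)
qed

lemma real_diff_times_binomial:
  "k \<le> j \<Longrightarrow> (real j - real k) * real (j choose k) = real j * real (j - 1 choose k)"
proof (cases j)
  case (Suc i)
  assume "k \<le> j"
  moreover have "(j - k) * (j choose k) = j * (j - 1 choose k)"
    using binomial_absorb_comp[of j k] by (simp add: Suc)
  ultimately show ?thesis
    by (metis of_nat_diff of_nat_mult)
qed simp

text \<open>The Appell property \<open>p_j' = j * p_(j-1)\<close> of the polynomials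
  \<open>p_j\<close> with coefficients \<open>gauss_coeff v j k\<close>, read off
  coefficientwise.\<close>

lemma gauss_coeff_lower:
  "real (Suc k) * gauss_coeff v j (Suc k) = real j * gauss_coeff v (j - 1) k"
  unfolding gauss_coeff_def using real_Suc_times_binomial_pred[of k j] by simp

text \<open>Pascal's rule splits off the first term; in the other one the moment recurrence produces
  a factor \<open>j - k\<close>, which the binomial absorbs.\<close>

lemma gauss_coeff_Suc:
  "gauss_coeff v (Suc j) k =
     (if k = 0 then 0 else gauss_coeff v j (k - 1)) + v * real j * gauss_coeff v (j - 1) k"
proof -
  have main: "real (j choose k) * gauss_moment v (Suc j - k) = v * real j * gauss_coeff v (j - 1) k"
  proof (cases "k \<le> j")
    case True
    then have "gauss_moment v (Suc j - k) = v * (real j - real k) * gauss_moment v (j - 1 - k)"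
      using gauss_moment_Suc[of v "j - k"] by (simp add: Suc_diff_le of_nat_diff diff_right_commute)
    then have "real (j choose k) * gauss_moment v (Suc j - k)
        = v * ((real j - real k) * real (j choose k)) * gauss_moment v (j - 1 - k)"
      by simp
    then show ?thesis
      unfolding real_diff_times_binomial[OF True] by (simp add: gauss_coeff_def)
  next
    case False
    then show ?thesis by (simp add: gauss_coeff_def binomial_eq_0)
  qed
  show ?thesis
  proof (cases k)
    case 0
    then show ?thesis using main by (simp add: gauss_coeff_def)
  next
    case (Suc i)
    then show ?thesis using main by (simp add: gauss_coeff_def algebra_simps)
  qed
qed

section \<open>Two expressions for the same generating function\<close>

text \<open>
  Both forms below have the exponential generating function \<open>exp (v x^2 / 2 + v y^2 / 2 + u x y)\<close>
  when \<open>u = v + s\<close>; differentiating it in \<open>x\<close> gives the recurrence by which they are identified.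
  The cut-off \<open>K\<close> is immaterial as soon as \<open>j \<le> K\<close>.
\<close>

definition gram_form :: "real \<Rightarrow> real \<Rightarrow> nat \<Rightarrow> nat \<Rightarrow> nat \<Rightarrow> real" where
  "gram_form v u K j m = (\<Sum>k\<le>K. fact k * u ^ k * gauss_coeff v j k * gauss_coeff v m k)"

definition moment_form :: "real \<Rightarrow> real \<Rightarrow> nat \<Rightarrow> nat \<Rightarrow> nat \<Rightarrow> real" where
  "moment_form v s K j m =
     (\<Sum>k\<le>K. fact k * s ^ k * real (j choose k) * real (m choose k) * gauss_moment v (j + m - 2 * k))"

text \<open>Row \<open>Suc j\<close> is expanded by \<open>gauss_coeff_Suc\<close>; its shifted term
  is reindexed, and \<open>gauss_coeff_lower\<close> moves the new factor \<open>Suc k\<close> onto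
  \<open>m\<close>.\<close>

lemma gram_form_Suc:
  assumes "j < K"
  shows "gram_form v u K (Suc j) m
    = v * real j * gram_form v u K (j - 1) m + u * real m * gram_form v u K j (m - 1)"
proof -
  obtain K' where K: "K = Suc K'" using assms by (cases K) auto
  have "(\<Sum>k\<le>K. fact k * u ^ k * (if k = 0 then 0 else gauss_coeff v j (k - 1)) * gauss_coeff v m k)
     = (\<Sum>k\<le>K'. fact (Suc k) * u ^ Suc k * gauss_coeff v j k * gauss_coeff v m (Suc k))"
    unfolding K by (subst sum.atMost_Suc_shift) simp
  also have "\<dots> = (\<Sum>k\<le>K'. fact k * u ^ Suc k * gauss_coeff v j k * (real (Suc k) * gauss_coeff v m (Suc k)))"
    by (intro sum.cong) (simp_all add: algebra_simps)
  also have "\<dots> = u * real m * (\<Sum>k\<le>K'. fact k * u ^ k * gauss_coeff v j k * gauss_coeff v (m - 1) k)"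
    unfolding gauss_coeff_lower sum_distrib_left by (intro sum.cong) (simp_all add: algebra_simps)
  \<comment> \<open>Raising the cut-off from \<open>K'\<close> to \<open>K\<close> adds only a zero
    term, since \<open>j < K\<close>.\<close>
  also have "\<dots> = u * real m * gram_form v u K j (m - 1)"
    using assms by (simp add: K gram_form_def gauss_coeff_eq_0)
  finally have 1: "(\<Sum>k\<le>K. fact k * u ^ k * (if k = 0 then 0 else gauss_coeff v j (k - 1)) * gauss_coeff v m k)
     = u * real m * gram_form v u K j (m - 1)" .
  show ?thesis
    unfolding 1[symmetric] unfolding gram_form_def gauss_coeff_Suc sum_distrib_left sum.distrib[symmetric]
    by (intro sum.cong) (simp_all add: algebra_simps)
qed

text \<open>Pascal's rule for \<open>Suc j choose k\<close> yields the contribution of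
  \<open>s\<close>, the moment recurrence those of \<open>v\<close>; this is how
  \<open>v + s\<close> arises.\<close>

lemma moment_form_Suc:
  assumes "j < K"
  shows "moment_form v s K (Suc j) m
    = v * real j * moment_form v s K (j - 1) m + (v + s) * real m * moment_form v s K j (m - 1)"
proof -
  obtain K' where K: "K = Suc K'" using assms by (cases K) auto
  have "(\<Sum>k\<le>K. fact k * s ^ k * real (if k = 0 then 0 else j choose (k - 1)) * real (m choose k)
          * gauss_moment v (Suc j + m - 2 * k))
     = (\<Sum>k\<le>K'. fact (Suc k) * s ^ Suc k * real (j choose k) * real (m choose Suc k)
          * gauss_moment v (Suc j + m - 2 * Suc k))"
    unfolding K by (subst sum.atMost_Suc_shift) simp
  also have "\<dots> = (\<Sum>k\<le>K'. fact k * s ^ Suc k * real (j choose k) * (real (Suc k) * real (m choose Suc k))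
          * gauss_moment v (Suc j + m - 2 * Suc k))"
    by (intro sum.cong) (simp_all add: algebra_simps)
  also have "\<dots> = s * real m * (\<Sum>k\<le>K'. fact k * s ^ k * real (j choose k) * real (m - 1 choose k)
          * gauss_moment v (j + (m - 1) - 2 * k))"
    unfolding real_Suc_times_binomial_pred sum_distrib_left
    by (cases m) (auto intro!: sum.cong simp: mult_ac)
  also have "\<dots> = s * real m * moment_form v s K j (m - 1)"
    using assms by (simp add: K moment_form_def binomial_eq_0)
  finally have 1: "(\<Sum>k\<le>K. fact k * s ^ k * real (if k = 0 then 0 else j choose (k - 1)) * real (m choose k)
          * gauss_moment v (Suc j + m - 2 * k)) = s * real m * moment_form v s K j (m - 1)" .
  \<comment> \<open>The factor \<open>j + m - 2 * k\<close> of the moment recurrence splits as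
    \<open>(j - k) + (m - k)\<close>, and each summand is absorbed by its own binomial.\<close>
  have 2: "real (j choose k) * real (m choose k) * gauss_moment v (Suc j + m - 2 * k)
     = v * real j * (real (j - 1 choose k) * real (m choose k) * gauss_moment v (j - 1 + m - 2 * k))
     + v * real m * (real (j choose k) * real (m - 1 choose k) * gauss_moment v (j + (m - 1) - 2 * k))" for k
  proof (cases "k \<le> j \<and> k \<le> m")
    case True
    have *: "gauss_moment v (Suc j + m - 2 * k)
        = v * ((real j - real k) + (real m - real k)) * gauss_moment v (j + m - 2 * k - 1)"
      using gauss_moment_Suc[of v "j + m - 2 * k"] True
      by (simp add: Suc_diff_le of_nat_diff)
    have j: "real j * real (j - 1 choose k) * gauss_moment v (j - 1 + m - 2 * k)
        = (real j - real k) * real (j choose k) * gauss_moment v (j + m - 2 * k - 1)"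
      using real_diff_times_binomial[of k j] True by (cases j) simp_all
    have m: "real m * real (m - 1 choose k) * gauss_moment v (j + (m - 1) - 2 * k)
        = (real m - real k) * real (m choose k) * gauss_moment v (j + m - 2 * k - 1)"
      using real_diff_times_binomial[of k m] True by (cases m) simp_all
    have "?thesis \<longleftrightarrow> real (j choose k) * real (m choose k) * gauss_moment v (Suc j + m - 2 * k)
     = v * real (m choose k) * (real j * real (j - 1 choose k) * gauss_moment v (j - 1 + m - 2 * k))
     + v * real (j choose k) * (real m * real (m - 1 choose k) * gauss_moment v (j + (m - 1) - 2 * k))"
      by (simp only: mult_ac)
    then show ?thesis
      unfolding * j m by (simp add: algebra_simps)
  next
    case False
    then show ?thesis by (auto simp: binomial_eq_0)
  qed
  have 3: "real (Suc j choose k) = real (if k = 0 then 0 else j choose (k - 1)) + real (j choose k)" for k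
    by (cases k) simp_all
  have "moment_form v s K (Suc j) m = s * real m * moment_form v s K j (m - 1)
     + (\<Sum>k\<le>K. fact k * s ^ k * (real (j choose k) * real (m choose k) * gauss_moment v (Suc j + m - 2 * k)))"
    unfolding 1[symmetric] unfolding moment_form_def 3 sum.distrib[symmetric]
    by (intro sum.cong) (simp_all add: algebra_simps)
  also have "(\<Sum>k\<le>K. fact k * s ^ k * (real (j choose k) * real (m choose k) * gauss_moment v (Suc j + m - 2 * k)))
     = v * real j * moment_form v s K (j - 1) m + v * real m * moment_form v s K j (m - 1)"
    unfolding 2 moment_form_def sum_distrib_left sum.distrib[symmetric]
    by (intro sum.cong) (simp_all add: algebra_simps)
  finally show ?thesis by (simp add: algebra_simps)
qed

text \<open>Both sides start from \<open>gauss_moment v m\<close> and obey the same recurrence in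
  \<open>j\<close>. It reaches back two steps and also lowers \<open>m\<close>, hence strong
  induction with \<open>m\<close> arbitrary.\<close>

lemma moment_form_eq_gram_form:
  "j \<le> K \<Longrightarrow> moment_form v s K j m = gram_form v (v + s) K j m"
proof (induction j arbitrary: m rule: less_induct)
  case (less j)
  show ?case
  proof (cases j)
    case 0
    have "moment_form v s K 0 m = gauss_moment v m"
      unfolding moment_form_def by (subst sum.remove[of _ 0]) (auto intro!: sum.neutral)
    moreover have "gram_form v (v + s) K 0 m = gauss_moment v m"
      unfolding gram_form_def
      by (subst sum.remove[of _ 0]) (auto intro!: sum.neutral simp: gauss_coeff_def)
    ultimately show ?thesis by (simp add: 0)
  next
    case (Suc i)
    then have "i < K" and le: "i - 1 < j" "i < j" "i - 1 \<le> K" "i \<le> K" using less.prems by auto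
    show ?thesis
      unfolding Suc moment_form_Suc[OF \<open>i < K\<close>] gram_form_Suc[OF \<open>i < K\<close>]
      using less.IH[OF le(1,3)] less.IH[OF le(2,4)] by simp
  qed
qed

section \<open>From the hypergeometric series to the moment form\<close>

lemma pochhammer_minus_nat: "pochhammer (- real m) k = (-1) ^ k * fact k * real (m choose k)"
  unfolding binomial_gbinomial gbinomial_pochhammer by (simp flip: power_add mult_2)

text \<open>Up to the sign \<open>(-1) ^ k\<close>, the Pochhammer product is the quotient of the
  two Gamma values, with its factors in reverse order.\<close>

lemma pochhammer_half_minus:
  "k \<le> n \<Longrightarrow> pochhammer (1 / 2 - real n) k * Gamma (real (n - k) + 1 / 2) = (-1) ^ k * Gamma (real n + 1 / 2)"
proof (induction k)
  case (Suc k)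
  then have eq: "n - k = Suc (n - Suc k)" by simp
  define x where "x = real (n - Suc k) + 1 / 2"
  have x: "real n - real k - 1 / 2 = x" "real (n - k) + 1 / 2 = x + 1"
    using Suc.prems by (simp_all add: x_def of_nat_diff)
  have "x > 0" by (simp add: x_def add_nonneg_pos)
  then have "Gamma (x + 1) = x * Gamma x"
    using nonpos_Ints_nonpos[of x] by (intro Gamma_plus1) force
  then have IH: "pochhammer (1 / 2 - real n) k * (x * Gamma x) = (-1) ^ k * Gamma (real n + 1 / 2)"
    using Suc x by (simp del: of_nat_diff)
  have "1 / 2 - real n + real k = - x" using x by simp
  then have "pochhammer (1 / 2 - real n) (Suc k) = - (pochhammer (1 / 2 - real n) k * x)"
    by (simp add: pochhammer_Suc)
  then show ?case
    using IH unfolding x_def[symmetric] by (simp add: mult_ac)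
qed simp

text \<open>The two sums agree term by term: numerator Pochhammer symbols give binomials, and Gamma
  over the denominator symbol gives the moment of order \<open>j + m - 2 * k\<close>.\<close>

lemma A_entry_eq:
  fixes \<sigma> \<rho> :: real
  assumes "\<sigma> > 0" "\<rho> > 0" and "j \<le> K"
  defines "b \<equiv> 2 * (\<rho> + \<sigma>) / (\<sigma> * (2 * \<rho> + \<sigma>))"
  shows "A_entry \<sigma> \<rho> j m
    = sqrt (2 * \<rho> * \<sigma> / (2 * \<rho> + \<sigma>)) * sqrt pi * moment_form (- b / 2) (1 / \<sigma>) K j m"
proof (cases "odd (j + m)")
  case True
  \<comment> \<open>The bounds on \<open>k\<close> prevent truncation, so the order keeps the parity
    of \<open>j + m\<close>; beyond them a binomial vanishes.\<close>
  then have "gauss_moment v (j + m - 2 * k) = 0" if "k \<le> j" "k \<le> m" for v k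
    using that by (intro gauss_moment_odd) auto
  then have "moment_form (- b / 2) (1 / \<sigma>) K j m = 0"
    unfolding moment_form_def by (intro sum.neutral) (metis binomial_eq_0 mult_eq_0_iff not_le of_nat_0)
  then show ?thesis using True by (simp add: A_entry_def)
next
  case False
  then obtain n where n: "j + m = 2 * n" by (blast elim: evenE)
  define z where "z = (2 * \<rho> + \<sigma>) / (2 * (\<rho> + \<sigma>))"
  have "\<sigma> \<noteq> 0" "2 * \<rho> + \<sigma> \<noteq> 0" "\<rho> + \<sigma> \<noteq> 0" using assms(1,2) by auto
  \<comment> \<open>This cancellation is the source of the parameter \<open>1 / \<sigma>\<close> of
    \<open>moment_form\<close>.\<close>
  then have bz: "b * z = 1 / \<sigma>" unfolding b_def z_def by (simp add: divide_simps)
  have half: "(real m + real j + 1) / 2 = real n + 1 / 2" "(1 - real m - real j) / 2 = 1 / 2 - real n"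
    "(m + j) div 2 = n"
    using n by (simp_all add: field_simps flip: of_nat_add)
  have summand: "(-1) ^ n * b ^ n * Gamma (real n + 1 / 2)
      * (pochhammer (- real m) k * pochhammer (- real j) k / pochhammer (1 / 2 - real n) k * (z ^ k / fact k))
     = sqrt pi * (fact k * (1 / \<sigma>) ^ k * real (j choose k) * real (m choose k)
      * gauss_moment (- b / 2) (j + m - 2 * k))" for k
  proof (cases "k \<le> j \<and> k \<le> m")
    case True
    then have k: "k \<le> n" using n by linarith
    have "Gamma (real n + 1 / 2) \<noteq> 0"
      by (intro less_imp_neq[symmetric] Gamma_real_pos) (simp add: add_nonneg_pos)
    then have nz: "pochhammer (1 / 2 - real n) k \<noteq> 0"
      using pochhammer_half_minus[OF k] by auto
    have G: "Gamma (real n + 1 / 2) / pochhammer (1 / 2 - real n) k = (-1) ^ k * Gamma (real (n - k) + 1 / 2)"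
      using pochhammer_half_minus[OF k] nz by (simp add: field_simps)
    have M: "sqrt pi * gauss_moment (- b / 2) (j + m - 2 * k) = (- b) ^ (n - k) * Gamma (real (n - k) + 1 / 2)"
      using gauss_moment_even[of "- b / 2" "n - k"] n by (simp add: diff_mult_distrib2)
    have p: "(- 1) ^ n * b ^ n * z ^ k * (-1) ^ k = (- b) ^ (n - k) * (1 / \<sigma>) ^ k"
    proof -
      have "(-1) ^ n * b ^ n = (- b) ^ (n - k) * (- b) ^ k"
        using k by (simp flip: power_add power_mult_distrib)
      then show ?thesis by (simp flip: bz power_mult_distrib)
    qed
    have "(-1) ^ n * b ^ n * Gamma (real n + 1 / 2)
      * (pochhammer (- real m) k * pochhammer (- real j) k / pochhammer (1 / 2 - real n) k * (z ^ k / fact k))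
      = (-1) ^ n * b ^ n * z ^ k * (Gamma (real n + 1 / 2) / pochhammer (1 / 2 - real n) k)
       * (fact k * real (j choose k) * real (m choose k)) * ((-1) ^ k * (-1) ^ k)"
      by (simp add: pochhammer_minus_nat)
    also have "\<dots> = ((- 1) ^ n * b ^ n * z ^ k * (-1) ^ k) * Gamma (real (n - k) + 1 / 2)
       * (fact k * real (j choose k) * real (m choose k))"
      unfolding G by (simp flip: power_mult_distrib)
    also have "\<dots> = (1 / \<sigma>) ^ k * (sqrt pi * gauss_moment (- b / 2) (j + m - 2 * k))
       * (fact k * real (j choose k) * real (m choose k))"
      unfolding p M by simp
    finally show ?thesis by (simp only: mult_ac)
  next
    case False
    then show ?thesis by (auto simp: pochhammer_minus_nat binomial_eq_0)
  qed
  \<comment> \<open>The series terminates: \<open>pochhammer (- real j) k\<close> vanishes for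
    \<open>k > j\<close>, hence beyond \<open>K\<close>.\<close>
  have "hyp2F1 (- real m) (- real j) (1 / 2 - real n) z
     = (\<Sum>k\<le>K. pochhammer (- real m) k * pochhammer (- real j) k / pochhammer (1 / 2 - real n) k * (z ^ k / fact k))"
    unfolding hyp2F1_def using assms(3)
    by (intro suminf_finite) (auto simp: pochhammer_minus_nat binomial_eq_0)
  then have "(-1) ^ n * b ^ n * Gamma (real n + 1 / 2) * hyp2F1 (- real m) (- real j) (1 / 2 - real n) z
     = sqrt pi * moment_form (- b / 2) (1 / \<sigma>) K j m"
    unfolding moment_form_def by (simp only: sum_distrib_left summand)
  then show ?thesis
    using False unfolding A_entry_def half by (simp add: z_def b_def mult_ac)
qed

section \<open>Hermite polynomials of arbitrary variance\<close>

fun scaled_hermite :: "complex \<Rightarrow> nat \<Rightarrow> complex \<Rightarrow> complex" where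
  "scaled_hermite v 0 x = 1"
| "scaled_hermite v (Suc 0) x = x"
| "scaled_hermite v (Suc (Suc n)) x =
     x * scaled_hermite v (Suc n) x - v * of_nat (Suc n) * scaled_hermite v n x"

lemma scaled_hermite_Suc:
  "scaled_hermite v (Suc n) x = x * scaled_hermite v n x - v * of_nat n * scaled_hermite v (n - 1) x"
  by (cases n) simp_all

text \<open>Homogeneity: the recurrence is weighted homogeneous, with weight one for
  \<open>x\<close> and two for \<open>v\<close>.\<close>

lemma scaled_hermite_scale:
  "a ^ n * scaled_hermite v n x = scaled_hermite (a\<^sup>2 * v) n (a * x)"
proof (induction n rule: less_induct)
  case (less n)
  consider "n = 0" | "n = 1" | k where "n = Suc (Suc k)"
    by (metis One_nat_def old.nat.exhaust)
  then show ?case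
  proof cases
    case 3
    then show ?thesis
      using less.IH[of k] less.IH[of "Suc k"] by (simp add: power2_eq_square algebra_simps)
  qed auto
qed

lemma has_field_derivative_scaled_hermite:
  "(scaled_hermite v n has_field_derivative of_nat n * scaled_hermite v (n - 1) x) (at x)"
proof (induction n rule: less_induct)
  case (less n)
  consider "n = 0" | "n = 1" | k where "n = Suc (Suc k)"
    by (metis One_nat_def old.nat.exhaust)
  then show ?case
  proof cases
    case 1
    have "scaled_hermite v 0 = (\<lambda>x. 1)" by auto
    then show ?thesis using 1 by simp
  next
    case 2
    have "scaled_hermite v 1 = (\<lambda>x. x)" by auto
    then show ?thesis using 2 by simp
  next
    case 3
    have eq: "scaled_hermite v n = (\<lambda>x. x * scaled_hermite v (Suc k) x - v * of_nat (Suc k) * scaled_hermite v k x)"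
      by (auto simp: 3)
    have d: "(scaled_hermite v (Suc k) has_field_derivative of_nat (Suc k) * scaled_hermite v k x) (at x)"
      "(scaled_hermite v k has_field_derivative of_nat k * scaled_hermite v (k - 1) x) (at x)"
      using less.IH[of "Suc k"] less.IH[of k] 3 by auto
    show ?thesis
      unfolding eq
      by (rule derivative_eq_intros d refl)+
        (simp add: 3 scaled_hermite_Suc[of v k] algebra_simps)
  qed
qed

text \<open>With \<open>P_n\<close> the polynomials of variance \<open>1 / 2\<close>,
  differentiating \<open>P_n * exp (- s^2)\<close> gives the factor
  \<open>n * P_(n-1) - 2 * s * P_n\<close>, which is \<open>-2 * P_(n+1)\<close>.\<close>

lemma hermite_H_eq_scaled_hermite: "hermite_H n t = 2 ^ n * scaled_hermite (1 / 2) n t"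
proof -
  have "(deriv ^^ n) (\<lambda>s. exp (- (s\<^sup>2))) = (\<lambda>s. (-2) ^ n * scaled_hermite (1 / 2) n s * exp (- (s\<^sup>2)))"
  proof (induction n)
    case (Suc n)
    have "deriv (\<lambda>s. (-2) ^ n * scaled_hermite (1 / 2) n s * exp (- (s\<^sup>2))) s
        = (-2) ^ Suc n * scaled_hermite (1 / 2) (Suc n) s * exp (- (s\<^sup>2))" for s
      by (rule DERIV_imp_deriv)
        (auto intro!: derivative_eq_intros has_field_derivative_scaled_hermite
           simp: scaled_hermite_Suc algebra_simps)
    then show ?case by (simp add: Suc.IH)
  qed simp
  then have "hermite_H n t
      = ((-1) ^ n * (-2) ^ n) * scaled_hermite (1 / 2) n t * (exp (t\<^sup>2) * exp (- (t\<^sup>2)))"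
    by (simp only: hermite_H_def mult_ac)
  also have "\<dots> = 2 ^ n * scaled_hermite (1 / 2) n t"
    by (simp add: exp_minus flip: power_mult_distrib)
  finally show ?thesis .
qed

section \<open>The Jacobi matrix and its characteristic polynomial\<close>

text \<open>\<open>x\<close> times the identity minus the Jacobi matrix of
  \<open>scaled_hermite v\<close>: each row encodes one instance of the three-term
  recurrence.\<close>

definition jacobi_pencil :: "complex \<Rightarrow> nat \<Rightarrow> complex \<Rightarrow> complex mat" where
  "jacobi_pencil v N x = mat N N (\<lambda>(l, k).
     (if k = l then x else 0) - (if k = Suc l then 1 else 0) - (if l = Suc k then v * of_nat l else 0))"

lemma jacobi_pencil_mult_vec:
  assumes "l < N" "dim_vec w = N"
  shows "(jacobi_pencil v N x *\<^sub>v w) $ l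
    = x * w $ l - (if Suc l < N then w $ Suc l else 0) - v * of_nat l * w $ (l - 1)"
proof -
  have "(jacobi_pencil v N x *\<^sub>v w) $ l
      = (\<Sum>k<N. (if k = l then x * w $ k else 0) - (if k = Suc l then w $ k else 0)
          - (if l = Suc k then v * of_nat l * w $ k else 0))"
    using assms unfolding jacobi_pencil_def
    by (auto simp: scalar_prod_def algebra_simps atLeast0LessThan intro!: sum.cong)
  also have "\<dots> = x * w $ l - (if Suc l < N then w $ Suc l else 0) - v * of_nat l * w $ (l - 1)"
    using assms by (cases l) (auto simp: sum_subtractf sum.delta)
  finally show ?thesis .
qed

text \<open>All rows but the last force a kernel vector to be a multiple of the values of the first
  \<open>N\<close> polynomials; the last row then asks the \<open>N\<close>-th one to
  vanish.\<close>

lemma det_jacobi_pencil_eq_0_iff: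
  assumes "N \<ge> 1"
  shows "det (jacobi_pencil v N x) = 0 \<longleftrightarrow> scaled_hermite v N x = 0"
proof -
  have carrier: "jacobi_pencil v N x \<in> carrier_mat N N"
    by (simp add: jacobi_pencil_def)
  show ?thesis
  proof
    assume "det (jacobi_pencil v N x) = 0"
    then obtain w where w: "w \<in> carrier_vec N" "w \<noteq> 0\<^sub>v N" "jacobi_pencil v N x *\<^sub>v w = 0\<^sub>v N"
      using det_0_iff_vec_prod_zero[OF carrier] by blast
    have row: "x * w $ l - (if Suc l < N then w $ Suc l else 0) - v * of_nat l * w $ (l - 1) = 0"
      if "l < N" for l
      using jacobi_pencil_mult_vec[OF that, of w v x] w that by simp
    have P: "w $ l = w $ 0 * scaled_hermite v l x" if "l < N" for l
      using that
    proof (induction l rule: less_induct)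
      case (less l)
      show ?case
      proof (cases l)
        case (Suc i)
        have "w $ l = x * w $ i - v * of_nat i * w $ (i - 1)"
          using row[of i] less.prems Suc by (simp add: diff_eq_eq eq_diff_eq add_ac)
        then show ?thesis
          using less.IH[of i] less.IH[of "i - 1"] less.prems Suc
          by (simp add: scaled_hermite_Suc algebra_simps)
      qed simp
    qed
    have "w $ 0 \<noteq> 0"
      using w(1,2) P by auto
    \<comment> \<open>This is the last row, where no entry \<open>w $ N\<close> exists to stand for
      the next polynomial.\<close>
    moreover have "w $ 0 * scaled_hermite v (Suc (N - 1)) x = 0"
      using row[of "N - 1"] P[of "N - 1"] P[of "N - 1 - 1"] assms
      unfolding scaled_hermite_Suc by (simp add: algebra_simps)
    ultimately show "scaled_hermite v N x = 0"
      using assms by simp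
  next
    assume 0: "scaled_hermite v N x = 0"
    define w where "w = vec N (\<lambda>l. scaled_hermite v l x)"
    have "jacobi_pencil v N x *\<^sub>v w = 0\<^sub>v N"
    proof (rule eq_vecI)
      fix l assume l: "l < dim_vec (0\<^sub>v N :: complex vec)"
      then have "scaled_hermite v (Suc l) x = 0" if "\<not> Suc l < N"
        using that 0 by (metis Suc_lessI index_zero_vec(2))
      then show "(jacobi_pencil v N x *\<^sub>v w) $ l = 0\<^sub>v N $ l"
        using l jacobi_pencil_mult_vec[of l N w v x] scaled_hermite_Suc[of v l x]
        by (auto simp: w_def)
    qed (use carrier in auto)
    moreover have "w $ 0 \<noteq> 0\<^sub>v N $ 0"
      using assms by (simp add: w_def)
    then have "w \<noteq> 0\<^sub>v N" by auto
    moreover have "w \<in> carrier_vec N" by (simp add: w_def)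
    ultimately show "det (jacobi_pencil v N x) = 0"
      using det_0_iff_vec_prod_zero[OF carrier] by blast
  qed
qed

section \<open>Factorisation of the pencil and comparison of zeros\<close>

text \<open>Row \<open>m\<close> holds the Hermite expansion of the \<open>m\<close>-th power, so
  the Jacobi matrix acts as multiplication by the variable, raising \<open>m\<close> to
  \<open>Suc m\<close>.\<close>

lemma mult_jacobi_pencil_index:
  assumes "m < N" "k < N"
  shows "(mat N N (\<lambda>(m, k). complex_of_real (gauss_coeff v m k)) * jacobi_pencil (of_real v) N x) $$ (m, k)
    = x * of_real (gauss_coeff v m k) - of_real (gauss_coeff v (Suc m) k)"
proof -
  let ?L = "\<lambda>m k. complex_of_real (gauss_coeff v m k)"
  have "(mat N N (\<lambda>(m, k). ?L m k) * jacobi_pencil (of_real v) N x) $$ (m, k)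
     = (\<Sum>l<N. (if l = k then x * ?L m l else 0) - (if k = Suc l then ?L m l else 0)
          - (if l = Suc k then of_real v * of_nat l * ?L m l else 0))"
    using assms unfolding jacobi_pencil_def
    by (auto simp: scalar_prod_def algebra_simps atLeast0LessThan intro!: sum.cong)
  \<comment> \<open>In the last column the index \<open>Suc k\<close> leaves the range, but its
    coefficient is zero because \<open>m < N\<close>.\<close>
  also have "\<dots> = x * ?L m k - (if k = 0 then 0 else ?L m (k - 1)) - of_real v * of_nat (Suc k) * ?L m (Suc k)"
    using assms by (cases k) (auto simp: sum_subtractf sum.delta gauss_coeff_eq_0)
  also have "of_real v * of_nat (Suc k) * ?L m (Suc k) = of_real (v * real m * gauss_coeff v (m - 1) k)"
    by (metis (no_types, lifting) gauss_coeff_lower mult.assoc of_real_mult of_real_of_nat_eq)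
  finally show ?thesis
    by (simp add: gauss_coeff_Suc)
qed

theorem mainTheorem4:
  fixes \<sigma> \<rho> :: real and N :: nat
  assumes "\<sigma> > 0" and "\<rho> > 0" and "N \<ge> 1"
  shows "{l :: complex. det (l \<cdot>\<^sub>m A_mat \<sigma> \<rho> N 0 - A_mat \<sigma> \<rho> N 1) = 0}
       = {l :: complex. hermite_H N
            (\<i> * complex_of_real (sqrt (\<sigma> * (2 * \<rho> + \<sigma>) / (2 * (\<rho> + \<sigma>)))) * l) = 0}"
proof -
  define b where "b = 2 * (\<rho> + \<sigma>) / (\<sigma> * (2 * \<rho> + \<sigma>))"
  define v where "v = - b / 2"
  define u where "u = v + 1 / \<sigma>"
  define c where "c = sqrt (2 * \<rho> * \<sigma> / (2 * \<rho> + \<sigma>)) * sqrt pi"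
  define q where "q = sqrt (\<sigma> * (2 * \<rho> + \<sigma>) / (2 * (\<rho> + \<sigma>)))"
  define L where "L = mat N N (\<lambda>(m, k). complex_of_real (gauss_coeff v m k))"
  \<comment> \<open>\<open>E\<close> is \<open>c * L * D\<close>, where \<open>D\<close> has
    diagonal entries \<open>fact k * u ^ k\<close>.\<close>
  define E where "E = mat N N (\<lambda>(j, k). complex_of_real (c * fact k * u ^ k * gauss_coeff v j k))"
  \<comment> \<open>The closed form shows \<open>u > 0\<close>, which keeps the diagonal of
    \<open>E\<close> away from zero.\<close>
  have "u = \<rho> / (\<sigma> * (2 * \<rho> + \<sigma>))"
  proof -
    have "\<sigma> \<noteq> 0" "2 * \<rho> + \<sigma> \<noteq> 0" using assms by auto
    then show ?thesis
      unfolding u_def v_def b_def by (simp add: divide_simps)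
  qed
  then have "u > 0" using assms by simp
  have "c > 0" using assms by (simp add: c_def)
  have q: "q > 0" "q\<^sup>2 * b = 1"
    using assms by (simp_all add: q_def b_def)
  \<comment> \<open>The bound on \<open>j\<close> alone permits the cut at \<open>N\<close>;
    \<open>m\<close> stays free because the shifted matrix also needs column
    \<open>N\<close>.\<close>
  have entry: "A_entry \<sigma> \<rho> j m = (\<Sum>k<N. (c * fact k * u ^ k * gauss_coeff v j k) * gauss_coeff v m k)"
    if "j < N" for j m
  proof -
    have "A_entry \<sigma> \<rho> j m = c * gram_form v u N j m"
      using A_entry_eq[OF assms(1,2), of j N m] moment_form_eq_gram_form[of j N v "1 / \<sigma>" m] that
      by (simp add: c_def v_def b_def u_def)
    then show ?thesis
      using that by (simp add: gram_form_def lessThan_Suc_atMost[symmetric] gauss_coeff_eq_0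
          sum_distrib_left mult_ac)
  qed
  have L: "L \<in> carrier_mat N N" and E: "E \<in> carrier_mat N N"
    by (simp_all add: L_def E_def)
  have detL: "det L \<noteq> 0"
    using det_lower_triangular[OF _ L]
    by (auto simp: L_def gauss_coeff_eq_0 gauss_coeff_self prod_list_diag_prod)
  have detE: "det E \<noteq> 0"
    using det_lower_triangular[OF _ E] \<open>u > 0\<close> \<open>c > 0\<close>
    by (auto simp: E_def gauss_coeff_eq_0 gauss_coeff_self prod_list_diag_prod)
  have J: "jacobi_pencil (of_real v) N l \<in> carrier_mat N N" for l
    by (simp add: jacobi_pencil_def)
  \<comment> \<open>The shift acts on the column index, which belongs to the transposed factor;
    hence the Jacobi pencil stands inside the transpose.\<close>
  have factor: "l \<cdot>\<^sub>m A_mat \<sigma> \<rho> N 0 - A_mat \<sigma> \<rho> N 1 = E * (L * jacobi_pencil (of_real v) N l)\<^sup>T" for l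
  proof (rule eq_matI)
    fix j m
    assume "j < dim_row (E * (L * jacobi_pencil (of_real v) N l)\<^sup>T)"
      and "m < dim_col (E * (L * jacobi_pencil (of_real v) N l)\<^sup>T)"
    then have jm: "j < N" "m < N" using J[of l] L E by auto
    let ?e = "\<lambda>k. complex_of_real (c * fact k * u ^ k * gauss_coeff v j k)"
    have "(E * (L * jacobi_pencil (of_real v) N l)\<^sup>T) $$ (j, m)
        = (\<Sum>k<N. E $$ (j, k) * (L * jacobi_pencil (of_real v) N l) $$ (m, k))"
      using jm J[of l] L E by (simp add: scalar_prod_def atLeast0LessThan)
    also have "\<dots> = (\<Sum>k<N. ?e k * (l * of_real (gauss_coeff v m k) - of_real (gauss_coeff v (Suc m) k)))"
      using jm unfolding L_def by (intro sum.cong) (simp_all add: mult_jacobi_pencil_index E_def del: index_mult_mat)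
    also have "\<dots> = l * (\<Sum>k<N. ?e k * of_real (gauss_coeff v m k)) - (\<Sum>k<N. ?e k * of_real (gauss_coeff v (Suc m) k))"
      by (simp add: sum_distrib_left sum_subtractf algebra_simps)
    also have "\<dots> = l * of_real (A_entry \<sigma> \<rho> j m) - of_real (A_entry \<sigma> \<rho> j (Suc m))"
      using jm by (simp add: entry)
    finally show "(l \<cdot>\<^sub>m A_mat \<sigma> \<rho> N 0 - A_mat \<sigma> \<rho> N 1) $$ (j, m)
        = (E * (L * jacobi_pencil (of_real v) N l)\<^sup>T) $$ (j, m)"
      using jm by (simp add: A_mat_def del: index_mult_mat)
  qed (use J L E in \<open>auto simp: A_mat_def\<close>)
  have "det (l \<cdot>\<^sub>m A_mat \<sigma> \<rho> N 0 - A_mat \<sigma> \<rho> N 1) = 0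
      \<longleftrightarrow> hermite_H N (\<i> * complex_of_real q * l) = 0" for l
  proof -
    have LJ: "L * jacobi_pencil (of_real v) N l \<in> carrier_mat N N"
      using L J by simp
    have "det (l \<cdot>\<^sub>m A_mat \<sigma> \<rho> N 0 - A_mat \<sigma> \<rho> N 1)
        = det E * (det L * det (jacobi_pencil (of_real v) N l))"
      unfolding factor using E L J LJ by (simp add: det_mult[of _ N] det_transpose[of _ N])
    then have "det (l \<cdot>\<^sub>m A_mat \<sigma> \<rho> N 0 - A_mat \<sigma> \<rho> N 1) = 0 \<longleftrightarrow> scaled_hermite (of_real v) N l = 0"
      using detL detE det_jacobi_pencil_eq_0_iff[OF assms(3)] by simp
    \<comment> \<open>The factor \<open>\<i>\<close> reverses the sign of the negative variance and
      \<open>q\<close> normalises it to the \<open>1 / 2\<close> of the physicist's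
      polynomials.\<close>
    moreover have "(\<i> * complex_of_real q)\<^sup>2 * of_real v = 1 / 2"
    proof -
      have "(\<i> * complex_of_real q)\<^sup>2 * of_real v = of_real (q\<^sup>2 * b / 2)"
        by (simp add: v_def power_mult_distrib)
      then show ?thesis by (simp add: q)
    qed
    then have "hermite_H N (\<i> * complex_of_real q * l)
        = 2 ^ N * ((\<i> * complex_of_real q) ^ N * scaled_hermite (of_real v) N l)"
      by (simp only: hermite_H_eq_scaled_hermite scaled_hermite_scale[of "\<i> * complex_of_real q"])
    ultimately show ?thesis using q by simp
  qed
  then show ?thesis unfolding q_def by simp
qed

end
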